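(* Let $m,n\ge1$, $P=mn$, and let $L$ be a real-valued twice differentiable loss function of a matrix parameter $W\in\mathbb{R}^{m\times n}$, identified with a function of $\theta=\mathrm{vec}(W)\in\mathbb{R}^P$. Fix a partition $\{1,\dots,P\}=I_1\sqcup\cdots\sqcup I_B$ into disjoint blocks. Let $W_t\in\mathbb{R}^{m\times n}$, $\theta_t=\mathrm{vec}(W_t)$, $\eta_t>0$, and $$O_t:=\mathrm{Ortho}(\nabla L(W_t)),\qquad o_t:=\mathrm{vec}(O_t),\qquad \theta_{t+1}=\theta_t-\eta_t\,o_t .$$ Assume there is a neighborhood $\mathcal{N}_t\subseteq\mathbb{R}^P$ of $\theta_t$ containing the segment $\{\theta_t+s(\theta_{t+1}-\theta_t):s\in[0,1]\}$ such that: 1. (Local Hessian Lipschitz) there is a constant $\rho_H>0$ with $\|\nabla^2L(\theta)-\nabla^2L(\theta')\|_2\le\rho_H\|\theta-\theta'\|_2$ for all $\theta,\theta'\in\mathcal{N}_t$; 2. (Local near block-diagonal Hessian) there is a constant $\delta_D\ge0$ with $\|\nabla^2L(\theta)-\nabla^2L_D(\theta)\|_2\le\delta_D$ for all $\theta\in\mathcal{N}_t$. Then $$L(\theta_{t+1})\le L(\theta_t)-\eta_t\|\nabla L(W_t)\|_{*}+\frac{\eta_t^2}{2}\bigl(\widetilde\Lambda_{O,t}+\delta_D\|o_t\|_2^2\bigr)+\frac{\eta_t^3\rho_H}{6}\|o_t\|_2^3,$$ where $\widetilde\Lambda_{O,t}:=\sum_{b=1}^B\bigl\|[\nabla^2L(\theta_t)]_b\bigr\|_2\,\|[o_t]_b\|_2^2$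 and $\|o_t\|_2^2=\|O_t\|_F^2=\min(m,n)$.
   Context: $\mathrm{vec}:\mathbb{R}^{m\times n}\to\mathbb{R}^{P}$ is a fixed vectorization (a linear listing of the $mn$ entries in some fixed order, e.g. column stacking or row stacking), so $\|\mathrm{vec}(W)\|_2=\|W\|_F$; the same vectorization is used for parameters, gradients and updates, and $\nabla L(W)\in\mathbb{R}^{m\times n}$ is the matrix with $\mathrm{vec}(\nabla L(W))=\nabla L(\theta)$. $\mathrm{Ortho}(G)$: if $G=U\Sigma V^\top$ is a thin singular value decomposition, with $r=\min(m,n)$, $U\in\mathbb{R}^{m\times r}$ and $V\in\mathbb{R}^{n\times r}$ having orthonormal columns and $\Sigma\in\mathbb{R}^{r\times r}$ diagonal with nonnegative entries, then $\mathrm{Ortho}(G):=UV^\top$ (a semi-orthogonal matrix; if $G$ is rank deficient, take any such decomposition). For $x\in\mathbb{R}^P$, $[x]_b:=x|_{I_b}$ is the subvector of coordinates in $I_b$. $[\nabla^2L(\theta)]_b$ is the principal submatrix of the Hessian $\nabla^2L(\theta)\in\mathbb{R}^{P\times P}$ with rows and columns indexed by $I_b$, and $\nabla^2L_D(\theta):=\mathrm{blockdiag}(\{[\nabla^2L(\theta)]_b\}_{b=1}^B)$ is the block-diagonal part of the Hessian, i.e. the $P\times P$ matrix agreeing with $\nabla^2L(\theta)$ on entries whose two indices lie in the same block and equal to $0$ elsewhere. For vectors $\|\cdot\|_2$ is the Euclidean norm, for matrices $\|\cdot\|_2$ is the spectral (operator) norm, $\|\cdot\|_F$ is the Frobenius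 norm and $\|\cdot\|_*$ is the nuclear norm (sum of singular values). *)

theory Defs
  imports "HOL-Analysis.Analysis"
begin

text \<open>
  A listing of the matrix entries is a bijection \<open>e :: 'p \<Rightarrow> 'm \<times> 'n\<close>; coordinate \<open>k\<close> of the
  vector holds the entry at position \<open>e k\<close>. Bijectivity of \<open>e\<close> forces
  \<open>CARD('p) = CARD('m) * CARD('n)\<close>.
\<close>

definition vectorize :: "('p \<Rightarrow> 'm \<times> 'n) \<Rightarrow> real^'n^'m \<Rightarrow> real^'p" where
  "vectorize e W = (\<chi> k. W $ fst (e k) $ snd (e k))"

definition unvectorize :: "('p \<Rightarrow> 'm \<times> 'n) \<Rightarrow> real^'p \<Rightarrow> real^'n^'m" where
  "unvectorize e x = (\<chi> i j. x $ inv e (i, j))"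

lemma vectorize_unvectorize: "bij e \<Longrightarrow> vectorize e (unvectorize e x) = x"
  by (simp add: vectorize_def unvectorize_def vec_eq_iff bij_is_inj)

lemma unvectorize_vectorize: "bij e \<Longrightarrow> unvectorize e (vectorize e W) = W"
  by (simp add: vectorize_def unvectorize_def vec_eq_iff bij_is_surj surj_f_inv_f)

definition gradient :: "(real^'p \<Rightarrow> real) \<Rightarrow> real^'p \<Rightarrow> real^'p" where
  "gradient f x = (THE D. GDERIV f x :> D)"

definition hessian :: "(real^'p \<Rightarrow> real) \<Rightarrow> real^'p \<Rightarrow> real^'p^'p" where
  "hessian f x = jacobian (gradient f) (at x)"

definition twice_differentiable :: "(real^'p \<Rightarrow> real) \<Rightarrow> bool" where
  "twice_differentiable f \<longleftrightarrow>
     (\<forall>x. f differentiable (at x)) \<and> (\<forall>x. gradient f differentiable (at x))"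

lemma gradient_eqI:
  assumes "GDERIV f x :> D"
  shows "gradient f x = D"
  unfolding gradient_def
proof (rule the_equality)
  show "GDERIV f x :> D" by (fact assms)
next
  fix D' assume "GDERIV f x :> D'"
  with assms have "(\<lambda>h. h \<bullet> D') = (\<lambda>h. h \<bullet> D)"
    unfolding gderiv_def by (rule has_derivative_unique[rotated])
  then show "D' = D"
    by (metis vector_eq_ldot)
qed

definition vectorized_fun ::
    "('p::finite \<Rightarrow> 'm \<times> 'n) \<Rightarrow> (real^'n^'m \<Rightarrow> real) \<Rightarrow> real^'p \<Rightarrow> real" where
  "vectorized_fun e L x = L (unvectorize e x)"

definition matrix_gradient ::
    "('p::finite \<Rightarrow> 'm \<times> 'n) \<Rightarrow> (real^'n^'m \<Rightarrow> real) \<Rightarrow> real^'n^'m \<Rightarrow> real^'n^'m" where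
  "matrix_gradient e L W = unvectorize e (gradient (vectorized_fun e L) (vectorize e W))"

abbreviation spectral_norm :: "real^'n^'m \<Rightarrow> real" where
  "spectral_norm A \<equiv> onorm ((*v) A)"

definition frobenius_norm :: "real^'n^'m \<Rightarrow> real" where
  "frobenius_norm A = sqrt (\<Sum>i\<in>UNIV. \<Sum>j\<in>UNIV. (A $ i $ j)\<^sup>2)"

definition right_singular_space :: "real^'n^'m \<Rightarrow> real \<Rightarrow> (real^'n) set" where
  "right_singular_space A s = {v. (transpose A ** A) *v v = s\<^sup>2 *\<^sub>R v}"

definition singular_values :: "real^'n^'m \<Rightarrow> real set" where
  "singular_values A = {s. 0 \<le> s \<and> right_singular_space A s \<noteq> {0}}"

text \<open>
  Each singular value is counted with its multiplicity, the dimension of the corresponding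
  eigenspace of \<open>A\<^sup>T A\<close>. Only the multiplicity of the value \<open>0\<close> depends on using \<open>A\<^sup>T A\<close>
  rather than \<open>A A\<^sup>T\<close>, and that term vanishes.
\<close>

definition nuclear_norm :: "real^'n^'m \<Rightarrow> real" where
  "nuclear_norm A = (\<Sum>s\<in>singular_values A. real (dim (right_singular_space A s)) * s)"

text \<open>
  The inner dimension \<open>r = min m n\<close> is carried by an index type \<open>'r\<close> of that cardinality.
\<close>

definition thin_svd :: "real^'n^'m \<Rightarrow> real^'r^'m \<Rightarrow> real^'r^'r \<Rightarrow> real^'r^'n \<Rightarrow> bool" where
  "thin_svd G U S V \<longleftrightarrow>
     CARD('r) = min CARD('m) CARD('n) \<and>
     transpose U ** U = mat 1 \<and>
     transpose V ** V = mat 1 \<and>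
     (\<forall>i j. i \<noteq> j \<longrightarrow> S $ i $ j = 0) \<and>
     (\<forall>i. 0 \<le> S $ i $ i) \<and>
     G = U ** S ** transpose V"

text \<open>
  A relation rather than a function, because \<open>U V\<^sup>T\<close> depends on the chosen decomposition
  when \<open>G\<close> is rank deficient.
\<close>

definition is_Ortho :: "'r::finite itself \<Rightarrow> real^'n^'m \<Rightarrow> real^'n^'m \<Rightarrow> bool" where
  "is_Ortho _ G Q \<longleftrightarrow>
     (\<exists>(U :: real^'r^'m) S V. thin_svd G U S V \<and> Q = U ** transpose V)"

text \<open>
  Subvectors and principal submatrices are extended by zero outside the block to the full
  index set; this changes neither the Euclidean nor the spectral norm.
\<close>

definition subvector :: "'p set \<Rightarrow> real^'p \<Rightarrow> real^'p" where
  "subvector J x = (\<chi> i. if i \<in> J then x $ i else 0)"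

definition principal_submatrix :: "'p set \<Rightarrow> real^'p^'p \<Rightarrow> real^'p^'p" where
  "principal_submatrix J A = (\<chi> i j. if i \<in> J \<and> j \<in> J then A $ i $ j else 0)"

lemma norm_subvector: "norm (subvector J x) = L2_set (($) x) J"
  for x :: "real^'p"
proof -
  have "(\<Sum>i\<in>UNIV. (if i \<in> J then x $ i else 0)\<^sup>2) = (\<Sum>i\<in>UNIV. if i \<in> J then (x $ i)\<^sup>2 else 0)"
    by (rule sum.cong) auto
  also have "\<dots> = (\<Sum>i\<in>J. (x $ i)\<^sup>2)"
    by (simp add: sum.If_cases)
  finally show ?thesis
    by (simp add: subvector_def norm_vec_def L2_set_def)
qed

lemma principal_submatrix_mult_vec:
  "principal_submatrix J A *v x = subvector J (A *v subvector J x)"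
  by (auto simp: principal_submatrix_def subvector_def matrix_vector_mult_def vec_eq_iff
      intro!: sum.cong)

definition block_diagonal_part :: "nat \<Rightarrow> (nat \<Rightarrow> 'p set) \<Rightarrow> real^'p^'p \<Rightarrow> real^'p^'p" where
  "block_diagonal_part B I A =
     (\<chi> i j. if \<exists>b\<in>{1..B}. i \<in> I b \<and> j \<in> I b then A $ i $ j else 0)"

end

theory Submission
  imports Defs
begin

text \<open>
  Along the update direction \<open>d = - \<eta> o\<close>, the Lipschitz Hessian gives the cubic Taylor bound
  \<open>l (\<theta> + d) \<le> l \<theta> + \<langle>\<nabla>l \<theta>, d\<rangle> + \<langle>H d, d\<rangle> / 2 + \<rho> \<parallel>d\<parallel>\<^sup>3 / 6\<close>. If \<open>U S V\<^sup>T\<close> is the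
  decomposition of the gradient, then \<open>\<langle>U S V\<^sup>T, U V\<^sup>T\<rangle> = tr S\<close>, which is the nuclear norm
  because the eigenspace of \<open>G\<^sup>T G\<close> for \<open>s\<^sup>2 > 0\<close> is spanned by the columns of \<open>V\<close> with
  \<open>S\<^sub>i\<^sub>i = s\<close>. The quadratic form of \<open>H\<close> splits into its block-diagonal part, which decouples
  over the blocks, and a remainder of norm at most \<open>\<delta>\<close>.
\<close>

section \<open>The Frobenius inner product\<close>

text \<open>On nested vectors \<open>\<bullet>\<close> is the Frobenius inner product; both sides
  are the same triple sum in a different order.\<close>

lemma inner_matrix_mult_left:
  fixes A :: "real^'k^'m" and B :: "real^'n^'k" and C :: "real^'n^'m"
  shows "(A ** B) \<bullet> C = B \<bullet> (transpose A ** C)"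
proof -
  have "(A ** B) \<bullet> C = (\<Sum>i\<in>UNIV. \<Sum>j\<in>UNIV. \<Sum>k\<in>UNIV. A$i$k * B$k$j * C$i$j)"
    by (simp add: inner_vec_def matrix_matrix_mult_def sum_distrib_right)
  also have "\<dots> = (\<Sum>i\<in>UNIV. \<Sum>k\<in>UNIV. \<Sum>j\<in>UNIV. A$i$k * B$k$j * C$i$j)"
    by (intro sum.cong refl sum.swap)
  also have "\<dots> = (\<Sum>k\<in>UNIV. \<Sum>i\<in>UNIV. \<Sum>j\<in>UNIV. A$i$k * B$k$j * C$i$j)"
    by (rule sum.swap)
  also have "\<dots> = (\<Sum>k\<in>UNIV. \<Sum>j\<in>UNIV. \<Sum>i\<in>UNIV. A$i$k * B$k$j * C$i$j)"
    by (intro sum.cong refl sum.swap)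
  also have "\<dots> = B \<bullet> (transpose A ** C)"
    by (simp add: inner_vec_def matrix_matrix_mult_def transpose_def sum_distrib_left mult_ac)
  finally show ?thesis .
qed

lemma inner_transpose: "transpose A \<bullet> transpose B = A \<bullet> B"
  for A B :: "real^'n^'m"
proof -
  have "transpose A \<bullet> transpose B = (\<Sum>j\<in>UNIV. \<Sum>i\<in>UNIV. A$i$j * B$i$j)"
    by (simp add: inner_vec_def transpose_def)
  also have "\<dots> = (\<Sum>i\<in>UNIV. \<Sum>j\<in>UNIV. A$i$j * B$i$j)"
    by (rule sum.swap)
  finally show ?thesis by (simp add: inner_vec_def)
qed

text \<open>Each outer factor cancels against its own transpose once moved across the inner product.
  \<open>U\<close> acts from the left and moves directly; transposing both arguments brings
  \<open>V\<close> to the left as well.\<close>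

lemma inner_orthonormal_sandwich:
  fixes U :: "real^'r^'m" and V :: "real^'r^'n"
  assumes U: "transpose U ** U = mat 1" and V: "transpose V ** V = mat 1"
  shows "(U ** A ** transpose V) \<bullet> (U ** C ** transpose V) = A \<bullet> C"
proof -
  have "(U ** A ** transpose V) \<bullet> (U ** C ** transpose V)
      = (A ** transpose V) \<bullet> (transpose U ** U ** (C ** transpose V))"
    by (metis inner_matrix_mult_left matrix_mul_assoc)
  also have "\<dots> = (A ** transpose V) \<bullet> (C ** transpose V)"
    by (simp add: U)
  also have "\<dots> = (V ** transpose A) \<bullet> (V ** transpose C)"
    by (subst inner_transpose[symmetric])
      (simp only: matrix_transpose_mul transpose_transpose)
  also have "\<dots> = transpose A \<bullet> (transpose V ** V ** transpose C)"
    by (simp add: inner_matrix_mult_left matrix_mul_assoc)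
  also have "\<dots> = A \<bullet> C"
    by (simp add: V inner_transpose)
  finally show ?thesis .
qed

lemma inner_mat_1: "A \<bullet> mat 1 = (\<Sum>i\<in>UNIV. A $ i $ i)"
  for A :: "real^'r^'r"
proof -
  have "A $ i \<bullet> mat 1 $ i = A $ i $ i" for i
    by (simp add: inner_vec_def mat_def if_distrib cong: if_cong)
  then show ?thesis by (simp add: inner_vec_def[of A])
qed

lemma inner_vectorize:
  fixes A C :: "real^'n^'m" and e :: "'p::finite \<Rightarrow> 'm \<times> 'n"
  assumes "bij e"
  shows "vectorize e A \<bullet> vectorize e C = A \<bullet> C"
proof -
  have "vectorize e A \<bullet> vectorize e C = (\<Sum>k\<in>UNIV. (\<lambda>(i, j). A$i$j * C$i$j) (e k))"
    by (simp add: inner_vec_def vectorize_def split_beta)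
  also have "\<dots> = (\<Sum>(i, j)\<in>UNIV. A$i$j * C$i$j)"
    using assms by (rule sum.reindex_bij_betw)
  also have "\<dots> = A \<bullet> C"
    by (simp add: inner_vec_def sum.cartesian_product)
  finally show ?thesis .
qed

lemma norm_eq_frobenius_norm: "norm A = frobenius_norm A"
  for A :: "real^'n^'m"
  by (simp add: norm_vec_def frobenius_norm_def L2_set_def sum_nonneg)

section \<open>The nuclear norm read off a thin SVD\<close>

lemma diagonal_mult_vec:
  fixes S :: "real^'r^'r"
  assumes "\<forall>i j. i \<noteq> j \<longrightarrow> S $ i $ j = 0"
  shows "(S *v w) $ i = S $ i $ i * w $ i"
proof -
  have "(\<Sum>j\<in>UNIV. S $ i $ j * w $ j) = (\<Sum>j\<in>UNIV. if j = i then S $ i $ i * w $ i else 0)"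
    using assms by (intro sum.cong) auto
  then show ?thesis by (simp add: matrix_vector_mult_def)
qed

text \<open>Since \<open>U\<close> cancels, G^T G = V S^2 V^T, and the injective map
  \<open>V\<close> carries the s^2-eigenspace of S^2, a coordinate subspace, onto that of G^T G.
  Positivity of \<open>s\<close> matters: the kernel of G^T G may also contain vectors orthogonal to
  the columns of \<open>V\<close>.\<close>

lemma dim_right_singular_space_thin_svd:
  fixes G :: "real^'n^'m" and S :: "real^'r^'r"
  assumes svd: "thin_svd G U S V" and s: "s > 0"
  shows "dim (right_singular_space G s) = card {i. S $ i $ i = s}"
proof -
  let ?J = "{i. S $ i $ i = s}"
  let ?E = "{w :: real^'r. \<forall>i. i \<notin> ?J \<longrightarrow> w $ i = 0}"
  have U: "transpose U ** U = mat 1" and V: "transpose V ** V = mat 1"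
    and diag: "\<forall>i j. i \<noteq> j \<longrightarrow> S $ i $ j = 0" and nonneg: "\<And>i. 0 \<le> S $ i $ i"
    and G: "G = U ** S ** transpose V"
    using svd by (auto simp: thin_svd_def)
  have "transpose S = S"
    using diag by (auto simp: transpose_def vec_eq_iff) metis
  then have "transpose G = V ** S ** transpose U"
    by (simp add: G matrix_transpose_mul transpose_transpose matrix_mul_assoc)
  then have "transpose G ** G = V ** S ** (transpose U ** U) ** S ** transpose V"
    by (simp add: G matrix_mul_assoc)
  \<comment> \<open>The row product \<open>v v* V\<close> stands for V^T v.\<close>
  then have GG: "(transpose G ** G) *v v = V *v (S *v (S *v (v v* V)))" for v
    by (simp only: U matrix_vector_mul_assoc matrix_mul_assoc matrix_mul_rid
        flip: transpose_matrix_vector)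
  have VtV: "(V *v w) v* V = w" for w
    by (simp only: V matrix_vector_mul_assoc matrix_vector_mul_lid flip: transpose_matrix_vector)
  have S2: "S *v (S *v w) = s\<^sup>2 *\<^sub>R w \<longleftrightarrow> w \<in> ?E" for w
  proof -
    \<comment> \<open>Taking square roots would also allow the entry -s, which nonnegativity of the
      diagonal excludes.\<close>
    have "S $ i $ i * (S $ i $ i * w $ i) = s\<^sup>2 * w $ i \<longleftrightarrow> S $ i $ i = s \<or> w $ i = 0" for i
      using nonneg[of i] s by (auto simp: power2_eq_square mult.assoc[symmetric] square_eq_iff)
    then show ?thesis
      by (auto simp: vec_eq_iff diagonal_mult_vec[OF diag])
  qed
  have "right_singular_space G s = (*v) V ` ?E"
  proof (intro equalityI subsetI)
    fix v assume "v \<in> right_singular_space G s"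
    then have eq: "V *v (S *v (S *v (v v* V))) = s\<^sup>2 *\<^sub>R v"
      by (simp add: right_singular_space_def GG)
    from arg_cong[OF this, of "\<lambda>x. x v* V"]
    have *: "S *v (S *v (v v* V)) = s\<^sup>2 *\<^sub>R (v v* V)"
      by (simp add: VtV scaleR_vector_matrix_assoc)
    then have E: "v v* V \<in> ?E"
      by (simp only: S2)
    \<comment> \<open>Replacing S^2 V^T v by s^2 V^T v and dividing by s^2 shows v = V V^T v, so
      \<open>v\<close> lies in the range of \<open>V\<close>.\<close>
    have "s\<^sup>2 *\<^sub>R (V *v (v v* V)) = s\<^sup>2 *\<^sub>R v"
      using eq unfolding * matrix_vector_mult_scaleR .
    then have "v = V *v (v v* V)"
      using s by simp
    with E show "v \<in> (*v) V ` ?E" by blast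
  next
    fix v assume "v \<in> (*v) V ` ?E"
    then obtain w where w: "w \<in> ?E" and v: "v = V *v w" by blast
    then show "v \<in> right_singular_space G s"
      using S2[of w] by (simp add: right_singular_space_def GG VtV matrix_vector_mult_scaleR)
  qed
  moreover have "dim ((*v) V ` ?E) = dim ?E"
  proof (rule dim_image_eq)
    show "linear ((*v) V)" by simp
    show "inj_on ((*v) V) (span ?E)" by (rule inj_on_inverseI[where g = "\<lambda>x. x v* V"]) (rule VtV)
  qed
  moreover have "dim ?E = card ?J"
    unfolding dim_vec_eq[symmetric] by (rule dim_substandard_cart)
  ultimately show ?thesis by simp
qed

text \<open>Grouping the diagonal entries by value turns the trace into a sum over singular values
  with multiplicity; the group of value 0 contributes nothing.\<close>

lemma nuclear_norm_thin_svd: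
  fixes G :: "real^'n^'m" and S :: "real^'r^'r"
  assumes svd: "thin_svd G U S V"
  shows "nuclear_norm G = (\<Sum>i\<in>UNIV. S $ i $ i)"
proof -
  let ?d = "\<lambda>i. S $ i $ i"
  let ?f = "\<lambda>s. real (dim (right_singular_space G s)) * s"
  have nonneg: "0 \<le> ?d i" for i
    using svd by (simp add: thin_svd_def)
  have zero: "right_singular_space G s = {0}"
    if "s > 0" "s \<notin> range ?d" for s
  proof -
    have "dim (right_singular_space G s) = 0"
      using that by (auto simp: dim_right_singular_space_thin_svd[OF svd] card_eq_0_iff)
    moreover have "0 \<in> right_singular_space G s"
      by (simp add: right_singular_space_def)
    ultimately show ?thesis by auto
  qed
  have sub: "singular_values G \<subseteq> insert 0 (range ?d)"
    using zero by (force simp: singular_values_def)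
  \<comment> \<open>The value 0 is inserted because G^T G can be singular even when every diagonal
    entry of \<open>S\<close> is positive. A diagonal entry that is not a singular value would have
    eigenspace {0}, hence a zero term.\<close>
  have "nuclear_norm G = sum ?f (insert 0 (range ?d))"
    unfolding nuclear_norm_def
  proof (rule sum.mono_neutral_left[OF _ sub])
    show "\<forall>s \<in> insert 0 (range ?d) - singular_values G. ?f s = 0"
      using nonneg by (auto simp: singular_values_def)
  qed simp
  also have "\<dots> = (\<Sum>s\<in>range ?d. ?f s)"
    by (simp add: sum.insert_if)
  also have "\<dots> = (\<Sum>s\<in>range ?d. \<Sum>i\<in>{i\<in>UNIV. ?d i = s}. ?d i)"
  proof (rule sum.cong[OF refl])
    fix s assume "s \<in> range ?d"
    then have "0 \<le> s" using nonneg by auto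
    then show "?f s = (\<Sum>i\<in>{i\<in>UNIV. ?d i = s}. ?d i)"
      by (cases "s = 0") (simp_all add: dim_right_singular_space_thin_svd[OF svd])
  qed
  also have "\<dots> = (\<Sum>i\<in>UNIV. ?d i)"
    by (rule sum.group) auto
  finally show ?thesis .
qed

section \<open>Quadratic forms and blocks\<close>

lemma inner_matrix_vector_le:
  fixes A :: "real^'p^'p"
  shows "(A *v x) \<bullet> x \<le> spectral_norm A * (norm x)\<^sup>2"
proof -
  have "(A *v x) \<bullet> x \<le> norm (A *v x) * norm x"
    by (rule norm_cauchy_schwarz)
  also have "\<dots> \<le> spectral_norm A * norm x * norm x"
    by (intro mult_right_mono onorm matrix_vector_mul_bounded_linear) simp
  finally show ?thesis by (simp add: power2_eq_square mult.assoc)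
qed

text \<open>By disjointness an index pair lies in at most one block, so each entry of the sum has at
  most one nonzero term.\<close>

lemma block_diagonal_part_eq_sum:
  assumes "disjoint_family_on I {1..B}"
  shows "block_diagonal_part B I A = (\<Sum>b\<in>{1..B}. principal_submatrix (I b) A)"
proof -
  have "(if \<exists>b\<in>{1..B}. i \<in> I b \<and> j \<in> I b then A $ i $ j else 0)
      = (\<Sum>b\<in>{1..B}. if i \<in> I b \<and> j \<in> I b then A $ i $ j else 0)" (is "?l = ?r") for i j
  proof (cases "\<exists>b\<in>{1..B}. i \<in> I b \<and> j \<in> I b")
    case True
    then obtain b where b: "b \<in> {1..B}" "i \<in> I b" "j \<in> I b" by blast
    then have uniq: "i \<in> I c \<and> j \<in> I c \<longleftrightarrow> c = b" if "c \<in> {1..B}" for c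
      using assms that b unfolding disjoint_family_on_def by (metis IntI empty_iff)
    have "?r = (\<Sum>c\<in>{1..B}. if c = b then A $ i $ j else 0)"
      by (rule sum.cong) (simp_all only: uniq)
    with b True show ?thesis by simp
  next
    case False
    then have "?r = 0" by (intro sum.neutral) auto
    then show ?thesis by (simp only: False if_False)
  qed
  then show ?thesis
    by (simp add: block_diagonal_part_def principal_submatrix_def vec_eq_iff)
qed

lemma inner_subvector: "subvector J y \<bullet> x = subvector J y \<bullet> subvector J x"
  by (auto simp: inner_vec_def subvector_def intro!: sum.cong)

text \<open>The submatrix sees only the block part of \<open>x\<close>, so the full vector can be
  replaced by its restriction before the spectral norm is applied.\<close>

lemma inner_principal_submatrix_le:
  "(principal_submatrix J A *v x) \<bullet> x
    \<le> spectral_norm (principal_submatrix J A) * (norm (subvector J x))\<^sup>2"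
proof -
  have "subvector J (subvector J x) = subvector J x"
    by (simp add: subvector_def vec_eq_iff)
  then have "(principal_submatrix J A *v x) \<bullet> x
      = (principal_submatrix J A *v subvector J x) \<bullet> subvector J x"
    by (metis principal_submatrix_mult_vec inner_subvector)
  then show ?thesis
    using inner_matrix_vector_le[of "principal_submatrix J A" "subvector J x"] by simp
qed

lemma inner_near_block_diagonal_le:
  assumes "disjoint_family_on I {1..B}"
    and "spectral_norm (A - block_diagonal_part B I A) \<le> \<delta>"
  shows "(A *v x) \<bullet> x
    \<le> (\<Sum>b\<in>{1..B}. spectral_norm (principal_submatrix (I b) A) * (norm (subvector (I b) x))\<^sup>2)
      + \<delta> * (norm x)\<^sup>2"
proof -
  let ?D = "block_diagonal_part B I A"
  have "(A *v x) \<bullet> x = (?D *v x) \<bullet> x + ((A - ?D) *v x) \<bullet> x"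
    by (simp add: matrix_vector_mult_diff_rdistrib inner_diff_left)
  moreover have "((A - ?D) *v x) \<bullet> x \<le> \<delta> * (norm x)\<^sup>2"
    by (rule order_trans[OF inner_matrix_vector_le mult_right_mono[OF assms(2)]]) simp
  moreover have "?D *v x = (\<Sum>b\<in>{1..B}. principal_submatrix (I b) A *v x)"
    unfolding block_diagonal_part_eq_sum[OF assms(1)]
    by (induction B) (simp_all add: matrix_vector_mult_add_rdistrib)
  then have "(?D *v x) \<bullet> x = (\<Sum>b\<in>{1..B}. (principal_submatrix (I b) A *v x) \<bullet> x)"
    by (simp add: inner_sum_left)
  then have "(?D *v x) \<bullet> x
      \<le> (\<Sum>b\<in>{1..B}. spectral_norm (principal_submatrix (I b) A) * (norm (subvector (I b) x))\<^sup>2)"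
    by (simp add: sum_mono inner_principal_submatrix_le)
  ultimately show ?thesis by linarith
qed

section \<open>Derivatives and the cubic Taylor bound\<close>

text \<open>Existence for the definite description in \<open>gradient\<close>: a linear functional
  \<open>f'\<close> is represented by the vector \<open>adjoint f' 1\<close>.\<close>

lemma has_gradient_gradient:
  fixes f :: "real^'p \<Rightarrow> real"
  assumes "f differentiable (at x)"
  shows "GDERIV f x :> gradient f x"
proof -
  obtain f' where f': "(f has_derivative f') (at x)"
    using assms by (auto simp: differentiable_def)
  then interpret linear f' by (rule has_derivative_linear)
  have "f' = (\<lambda>h. h \<bullet> adjoint f' 1)"
    using adjoint_works[OF linear_axioms, of _ 1] by auto
  then have "GDERIV f x :> adjoint f' 1"
    using f' unfolding gderiv_def by metis
  then show ?thesis using gradient_eqI by metis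
qed

lemma has_derivative_gradient_hessian:
  fixes f :: "real^'p \<Rightarrow> real"
  assumes "gradient f differentiable (at x)"
  shows "(gradient f has_derivative (\<lambda>h. hessian f x *v h)) (at x)"
  using assms unfolding hessian_def by (simp add: jacobian_works[symmetric])

text \<open>Two monotonicity arguments replace double integration, so no continuity of
  \<open>\<phi>''\<close> is required. Integrating c s twice gives c/2 and then c/6.\<close>

lemma taylor_cubic_upper_bound:
  fixes \<phi> :: "real \<Rightarrow> real"
  assumes d1: "\<And>s. (\<phi> has_real_derivative \<phi>' s) (at s)"
    and d2: "\<And>s. (\<phi>' has_real_derivative \<phi>'' s) (at s)"
    and bound: "\<And>s. 0 \<le> s \<Longrightarrow> s \<le> 1 \<Longrightarrow> \<phi>'' s \<le> \<phi>'' 0 + c * s"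
  shows "\<phi> 1 \<le> \<phi> 0 + \<phi>' 0 + \<phi>'' 0 / 2 + c / 6"
proof -
  have first: "\<phi>' s - s * \<phi>'' 0 - c * s\<^sup>2 / 2 \<le> \<phi>' 0" if "0 \<le> s" "s \<le> 1" for s
  proof -
    let ?h = "\<lambda>s. \<phi>' s - s * \<phi>'' 0 - c * s\<^sup>2 / 2"
    have "?h s \<le> ?h 0"
    proof (rule DERIV_nonpos_imp_nonincreasing[where f = ?h, OF that(1)])
      fix x assume "0 \<le> x" "x \<le> s"
      then show "\<exists>y. (?h has_real_derivative y) (at x) \<and> y \<le> 0"
        using that bound[of x]
        by (intro exI[of _ "\<phi>'' x - \<phi>'' 0 - c * x"])
          (auto intro!: derivative_eq_intros d2)
    qed
    then show ?thesis by simp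
  qed
  let ?k = "\<lambda>s. \<phi> s - s * \<phi>' 0 - s\<^sup>2 / 2 * \<phi>'' 0 - c * s ^ 3 / 6"
  have "?k 1 \<le> ?k 0"
  proof (rule DERIV_nonpos_imp_nonincreasing[where f = ?k])
    fix x :: real assume "0 \<le> x" "x \<le> 1"
    then show "\<exists>y. (?k has_real_derivative y) (at x) \<and> y \<le> 0"
      using first[of x]
      by (intro exI[of _ "\<phi>' x - \<phi>' 0 - x * \<phi>'' 0 - c * x\<^sup>2 / 2"])
        (auto intro!: derivative_eq_intros d1)
  qed simp
  then show ?thesis by simp
qed

text \<open>Restriction to the line through \<open>x\<close> along \<open>d\<close> reduces to one
  variable with c = \<rho> ||d||^3: one factor ||d|| comes from the displacement, two from the
  quadratic form.\<close>

lemma lipschitz_hessian_upper_bound: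
  fixes f :: "real^'p \<Rightarrow> real"
  assumes diff: "twice_differentiable f"
    and lipschitz: "\<And>s. 0 \<le> s \<Longrightarrow> s \<le> 1 \<Longrightarrow>
      spectral_norm (hessian f (x + s *\<^sub>R d) - hessian f x) \<le> \<rho> * norm (s *\<^sub>R d)"
  shows "f (x + d)
    \<le> f x + gradient f x \<bullet> d + (hessian f x *v d) \<bullet> d / 2 + \<rho> * norm d ^ 3 / 6"
proof -
  let ?p = "\<lambda>s. x + s *\<^sub>R d"
  let ?\<phi>'' = "\<lambda>s. (hessian f (?p s) *v d) \<bullet> d"
  have line: "(?p has_derivative (\<lambda>h. h *\<^sub>R d)) (at s)" for s
    by (auto intro!: derivative_eq_intros)
  have d1: "((\<lambda>s. f (?p s)) has_real_derivative gradient f (?p s) \<bullet> d) (at s)" for s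
  proof -
    have "(f has_derivative (\<lambda>h. h \<bullet> gradient f (?p s))) (at (?p s))"
      using has_gradient_gradient[of f "?p s"] diff
      by (simp add: twice_differentiable_def gderiv_def)
    from has_derivative_compose[OF line this] show ?thesis
      by (simp add: has_field_derivative_def inner_commute mult_commute_abs)
  qed
  have d2: "((\<lambda>s. gradient f (?p s) \<bullet> d) has_real_derivative ?\<phi>'' s) (at s)" for s
  proof -
    have "(gradient f has_derivative (\<lambda>h. hessian f (?p s) *v h)) (at (?p s))"
      using diff by (simp add: has_derivative_gradient_hessian twice_differentiable_def)
    from has_derivative_inner_left[OF has_derivative_compose[OF line this], of d]
    show ?thesis
      by (simp add: has_field_derivative_def matrix_vector_mult_scaleR mult_commute_abs)
  qed
  have "?\<phi>'' s \<le> ?\<phi>'' 0 + \<rho> * norm d ^ 3 * s" if s: "0 \<le> s" "s \<le> 1" for s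
  proof -
    let ?A = "hessian f (?p s) - hessian f x"
    have "?\<phi>'' s - ?\<phi>'' 0 = (?A *v d) \<bullet> d"
      by (simp add: matrix_vector_mult_diff_rdistrib inner_diff_left)
    also have "\<dots> \<le> spectral_norm ?A * (norm d)\<^sup>2"
      by (rule inner_matrix_vector_le)
    also have "\<dots> \<le> \<rho> * norm (s *\<^sub>R d) * (norm d)\<^sup>2"
      by (intro mult_right_mono lipschitz s) simp
    also have "\<dots> = \<rho> * norm d ^ 3 * s"
      using s by (simp add: power2_eq_square power3_eq_cube)
    finally show ?thesis by simp
  qed
  from taylor_cubic_upper_bound[OF d1 d2 this] show ?thesis by simp
qed

section \<open>The descent inequality\<close>

theorem theoremA4:
  fixes e :: "'p::finite \<Rightarrow> 'm::finite \<times> 'n::finite"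
    and L :: "real^'n^'m \<Rightarrow> real"
    and l :: "real^'p \<Rightarrow> real"
    and B :: nat and I :: "nat \<Rightarrow> 'p set"
    and W Ot :: "real^'n^'m"
    and \<theta> \<theta>' ot :: "real^'p"
    and \<eta> \<rho> \<delta> :: real
    and N :: "(real^'p) set"
  assumes e: "bij e"
    and l: "l = vectorized_fun e L"
    and diff: "twice_differentiable l"
    and blocks_disjoint: "disjoint_family_on I {1..B}"
    and blocks_cover: "(\<Union>b\<in>{1..B}. I b) = UNIV"
    and \<theta>: "\<theta> = vectorize e W"
    and \<eta>: "\<eta> > 0"
    and Ot: "is_Ortho TYPE('r::finite) (matrix_gradient e L W) Ot"
    and ot: "ot = vectorize e Ot"
    and \<theta>': "\<theta>' = \<theta> - \<eta> *\<^sub>R ot"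
    and nbhd: "\<theta> \<in> interior N"
    and segment: "{\<theta> + s *\<^sub>R (\<theta>' - \<theta>) | s. s \<in> {0..1}} \<subseteq> N"
    and \<rho>: "\<rho> > 0"
    and hessian_lipschitz:
      "\<And>x y. x \<in> N \<Longrightarrow> y \<in> N \<Longrightarrow> spectral_norm (hessian l x - hessian l y) \<le> \<rho> * norm (x - y)"
    and \<delta>: "\<delta> \<ge> 0"
    and near_block_diagonal:
      "\<And>x. x \<in> N \<Longrightarrow> spectral_norm (hessian l x - block_diagonal_part B I (hessian l x)) \<le> \<delta>"
  shows "l \<theta>' \<le> l \<theta> - \<eta> * nuclear_norm (matrix_gradient e L W)
           + \<eta>\<^sup>2 / 2 *
             ((\<Sum>b\<in>{1..B}. spectral_norm (principal_submatrix (I b) (hessian l \<theta>))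
                             * (norm (subvector (I b) ot))\<^sup>2)
              + \<delta> * (norm ot)\<^sup>2)
           + \<eta> ^ 3 * \<rho> / 6 * norm ot ^ 3
         \<and> (norm ot)\<^sup>2 = (frobenius_norm Ot)\<^sup>2
         \<and> (frobenius_norm Ot)\<^sup>2 = real (min CARD('m) CARD('n))"
proof -
  let ?G = "matrix_gradient e L W"
  obtain U :: "real^'r^'m" and S V where svd: "thin_svd ?G U S V" and Q: "Ot = U ** transpose V"
    using Ot by (auto simp: is_Ortho_def)
  have U: "transpose U ** U = mat 1" and V: "transpose V ** V = mat 1"
    and G: "?G = U ** S ** transpose V"
    and r: "CARD('r) = min CARD('m) CARD('n)"
    using svd by (auto simp: thin_svd_def)
  \<comment> \<open>The identity in the middle lets the sandwich lemma give both <G, O> = tr S and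
    ||O||^2 = tr 1 = r.\<close>
  have Q': "Ot = U ** mat 1 ** transpose V"
    by (simp add: Q)

  have "gradient l \<theta> = vectorize e ?G"
    by (simp add: matrix_gradient_def vectorize_unvectorize[OF e] l \<theta>)
  then have "gradient l \<theta> \<bullet> ot = ?G \<bullet> Ot"
    by (simp add: ot inner_vectorize[OF e])
  also have "\<dots> = nuclear_norm ?G"
    unfolding nuclear_norm_thin_svd[OF svd]
    by (subst G, subst Q') (simp only: inner_orthonormal_sandwich[OF U V] inner_mat_1)
  finally have nuclear: "gradient l \<theta> \<bullet> ot = nuclear_norm ?G" .

  have norm_ot: "norm ot = frobenius_norm Ot"
    by (simp add: ot norm_eq_sqrt_inner inner_vectorize[OF e] flip: norm_eq_frobenius_norm)
  have "(frobenius_norm Ot)\<^sup>2 = Ot \<bullet> Ot"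
    by (simp add: power2_norm_eq_inner flip: norm_eq_frobenius_norm)
  also have "\<dots> = real CARD('r)"
    unfolding Q' inner_orthonormal_sandwich[OF U V] inner_mat_1 by (simp add: mat_def)
  finally have frobenius: "(frobenius_norm Ot)\<^sup>2 = real (min CARD('m) CARD('n))"
    by (simp only: r)

  have step: "\<theta>' = \<theta> + (- \<eta>) *\<^sub>R ot"
    by (simp add: \<theta>')
  have on_segment: "\<theta> + s *\<^sub>R ((- \<eta>) *\<^sub>R ot) \<in> N" if "0 \<le> s" "s \<le> 1" for s
    using segment that by (force simp: step)
  have \<theta>N: "\<theta> \<in> N"
    using nbhd interior_subset by blast
  have "spectral_norm (hessian l (\<theta> + s *\<^sub>R ((- \<eta>) *\<^sub>R ot)) - hessian l \<theta>)
      \<le> \<rho> * norm (s *\<^sub>R ((- \<eta>) *\<^sub>R ot))" if "0 \<le> s" "s \<le> 1" for s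
    using hessian_lipschitz[OF on_segment[OF that] \<theta>N] by simp
  \<comment> \<open>With d = -\<eta> o the linear term yields -\<eta> times the nuclear norm, the
    quadratic term loses the sign, and \<eta> > 0 gives ||d||^3 = \<eta>^3 ||o||^3.\<close>
  from lipschitz_hessian_upper_bound[OF diff this]
  have "l \<theta>' \<le> l \<theta> - \<eta> * nuclear_norm ?G + \<eta>\<^sup>2 / 2 * ((hessian l \<theta> *v ot) \<bullet> ot)
      + \<eta> ^ 3 * \<rho> / 6 * norm ot ^ 3"
    unfolding step matrix_vector_mult_scaleR
    using \<eta> by (simp add: nuclear power_mult_distrib mult_ac power2_eq_square)
  moreover have "\<eta>\<^sup>2 / 2 * ((hessian l \<theta> *v ot) \<bullet> ot) \<le> \<eta>\<^sup>2 / 2 *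
             ((\<Sum>b\<in>{1..B}. spectral_norm (principal_submatrix (I b) (hessian l \<theta>))
                             * (norm (subvector (I b) ot))\<^sup>2)
              + \<delta> * (norm ot)\<^sup>2)"
    by (intro mult_left_mono inner_near_block_diagonal_le blocks_disjoint near_block_diagonal \<theta>N)
      simp
  ultimately show ?thesis
    using norm_ot frobenius by auto
qed

end
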